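(* Let $G$ be a connected, semi-balanced directed graph with an arbitrarily fixed ribbon structure and basis. Then the simplices $\mathcal{Q}_T$, where $T$ ranges over the Jaeger trees of $G$ with respect to this ribbon structure and basis, dissect the root polytope $\mathcal{Q}_G$; that is, they are maximal dimensional simplices in $\mathcal{Q}_G$ with mutually disjoint interiors (relative to the affine hull of $\mathcal{Q}_G$) whose union is $\mathcal{Q}_G$.
   Context: A directed graph is an orientation of a finite graph without loops and multiple edges; $\overrightarrow{th}$ denotes an edge with tail $t$ and head $h$, and $xy$ an edge whose orientation is not specified. Connectedness, cycles and spanning trees are meant in the underlying undirected graph. A cycle is semi-balanced if it has the same number of edges going in the two directions around the cycle; a directed graph is semi-balanced if all of its cycles are semi-balanced. For a directed graph $G=(V,E)$ let $\mathbf{v}\in\mathbf{R}^V$ be the standard basis vector of $v\in V$. The root polytope is $\mathcal{Q}_G=\mathrm{Conv}\{\mathbf{h}-\mathbf{t}\mid \overrightarrow{th}\in E\}\subset\mathbf{R}^V$; for a subgraph (or edge set) $S$ of $G$, $\mathcal{Q}_S=\mathrm{Conv}\{\mathbf{h}-\mathbf{t}\mid \overrightarrow{th}\in S\}$. (For a spanning tree $T$, $\mathcal{Q}_T$ is a simplex.) A ribbon structure on $G$ is a choice, for each vertex $x$, of a cyclic permutation of the edges incident to $x$; $xy^+$ denotes the edge following $xy$ at $x$, and $yx^+$ the edge following $yx$ at $y$. A basis is a pair $(b_0,b_0b_1)$ where $b_0$ is a vertex and $b_0b_1$ is an edge incident to $b_0$ (with $b_0$ its head or its tail). The tour of a spanning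 tree $T$ is the sequence of node-edge pairs starting with $(b_0,b_0b_1)$ such that if the current pair is $(x,xy)$ and $xy\notin T$ then the next pair is $(x,xy^+)$, while if $xy\in T$ then the next pair is $(y,yx^+)$; it stops right before $(b_0,b_0b_1)$ would become current again. (Each incident node-edge pair occurs exactly once in the tour.) A spanning tree $T$ is a Jaeger tree if for each edge $\overrightarrow{th}\notin T$ the pair $(t,th)$ precedes the pair $(h,th)$ in the tour of $T$. *)

theory Defs
  imports
    "HOL-Analysis.Analysis"
    "HOL-Combinatorics.Orbits"
    "Graph_Theory.Digraph_Component"
begin

text \<open>
  The vertex set is the whole (finite, arbitrary) type, so that the polytopes live in
  \<open>real ^ 'v\<close>. An edge is the pair \<open>(t, h)\<close> of its tail and head. The locale predicate
  \<open>pair_digraph\<close> gives finiteness and the absence of loops; the last conjunct says that no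
  two edges have the same underlying undirected edge.
\<close>

definition directed_graph :: "'v::finite pair_pre_digraph \<Rightarrow> bool" where
  "directed_graph G \<longleftrightarrow>
     pair_digraph G \<and> pverts G = UNIV \<and>
     (\<forall>t h. (t, h) \<in> parcs G \<longrightarrow> (h, t) \<notin> parcs G)"

definition incident_edges :: "'v::finite pair_pre_digraph \<Rightarrow> 'v \<Rightarrow> ('v \<times> 'v) set" where
  "incident_edges G x = in_arcs (with_proj G) x \<union> out_arcs (with_proj G) x"

text \<open>
  Cycles of the underlying undirected graph, traversed in one of the two directions:
  \<open>(u, v)\<close> in the list means that the edge joining \<open>u\<close> and \<open>v\<close> is walked from \<open>u\<close> to \<open>v\<close>,
  whatever its orientation in \<open>G\<close>. The bound on the length removes the closed walks
  \<open>[(u, v), (v, u)]\<close> along a single edge, which are cycles of the symmetric closure but not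
  of the underlying graph.

  The library constants \<open>forest\<close>, \<open>tree\<close> and \<open>spanning_tree\<close> only exclude directed cycles
  and are therefore not the notions needed here.
\<close>

definition underlying_cycle :: "'v::finite pair_pre_digraph \<Rightarrow> ('v \<times> 'v) list \<Rightarrow> bool" where
  "underlying_cycle G p \<longleftrightarrow>
     pre_digraph.cycle (with_proj (mk_symmetric (with_proj G))) p \<and> 3 \<le> length p"

definition semi_balanced :: "'v::finite pair_pre_digraph \<Rightarrow> bool" where
  "semi_balanced G \<longleftrightarrow>
     (\<forall>p. underlying_cycle G p \<longrightarrow>
        length (filter (\<lambda>(u, v). (u, v) \<in> parcs G) p) =
        length (filter (\<lambda>(u, v). (v, u) \<in> parcs G) p))"

definition undirected_spanning_tree ::
    "'v::finite pair_pre_digraph \<Rightarrow> 'v pair_pre_digraph \<Rightarrow> bool" where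
  "undirected_spanning_tree T G \<longleftrightarrow>
     spanning (with_proj T) (with_proj G) \<and>
     Digraph_Component.connected (with_proj T) \<and>
     \<not> (\<exists>p. underlying_cycle T p)"

definition root_polytope :: "'v::finite pair_pre_digraph \<Rightarrow> (real ^ 'v) set" where
  "root_polytope S = convex hull ((\<lambda>(t, h). axis h 1 - axis t 1) ` parcs S)"

text \<open>\<open>\<rho> x\<close> maps an edge incident to \<open>x\<close> to the edge following it at \<open>x\<close>.\<close>

definition ribbon_structure ::
    "'v::finite pair_pre_digraph \<Rightarrow> ('v \<Rightarrow> 'v \<times> 'v \<Rightarrow> 'v \<times> 'v) \<Rightarrow> bool" where
  "ribbon_structure G \<rho> \<longleftrightarrow>
     (\<forall>x. \<rho> x permutes incident_edges G x \<and>
          (incident_edges G x \<noteq> {} \<longrightarrow> cyclic_on (\<rho> x) (incident_edges G x)))"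

definition other_end :: "'v \<Rightarrow> 'v \<times> 'v \<Rightarrow> 'v" where
  "other_end x e = (if x = fst e then snd e else fst e)"

fun tour_step ::
    "('v \<Rightarrow> 'v \<times> 'v \<Rightarrow> 'v \<times> 'v) \<Rightarrow> 'v::finite pair_pre_digraph \<Rightarrow>
     'v \<times> ('v \<times> 'v) \<Rightarrow> 'v \<times> ('v \<times> 'v)" where
  "tour_step \<rho> T (x, e) =
     (if e \<in> parcs T then (other_end x e, \<rho> (other_end x e) e) else (x, \<rho> x e))"

text \<open>
  The least positive return time exists when \<open>\<rho>\<close> is a ribbon structure and \<open>b\<close> is an incident
  node-edge pair of the graph, since \<open>tour_step \<rho> T\<close> then permutes the finite set of such pairs.
\<close>

definition tour ::
    "('v \<Rightarrow> 'v \<times> 'v \<Rightarrow> 'v \<times> 'v) \<Rightarrow> 'v \<times> ('v \<times> 'v) \<Rightarrow> 'v::finite pair_pre_digraph \<Rightarrow>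
     ('v \<times> ('v \<times> 'v)) list" where
  "tour \<rho> b T =
     map (\<lambda>i. (tour_step \<rho> T ^^ i) b) [0..<(LEAST n. 0 < n \<and> (tour_step \<rho> T ^^ n) b = b)]"

definition precedes :: "'a list \<Rightarrow> 'a \<Rightarrow> 'a \<Rightarrow> bool" where
  "precedes xs p q \<longleftrightarrow> (\<exists>i j. i < j \<and> j < length xs \<and> xs ! i = p \<and> xs ! j = q)"

definition jaeger_tree ::
    "'v::finite pair_pre_digraph \<Rightarrow> ('v \<Rightarrow> 'v \<times> 'v \<Rightarrow> 'v \<times> 'v) \<Rightarrow> 'v \<times> ('v \<times> 'v) \<Rightarrow>
     'v pair_pre_digraph \<Rightarrow> bool" where
  "jaeger_tree G \<rho> b T \<longleftrightarrow>
     undirected_spanning_tree T G \<and>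
     (\<forall>t h. (t, h) \<in> parcs G - parcs T \<longrightarrow>
        precedes (tour \<rho> b T) (t, (t, h)) (h, (t, h)))"

end

theory Submission
  imports Defs
begin

text \<open>
  Spanning trees are handled through their cuts. Deleting an edge \<open>f\<close> of a spanning tree \<open>T\<close>
  leaves two sides; let \<open>S\<close> be the side of the head of \<open>f\<close>. The inner product of the indicator
  vector of \<open>S\<close> with \<open>h - t\<close> is \<open>1\<close>, \<open>-1\<close> or \<open>0\<close> according to whether the edge enters \<open>S\<close>,
  leaves it or does not cross it. So on the edges of \<open>T\<close> this functional is \<open>1\<close> on \<open>f\<close> and \<open>0\<close>
  elsewhere: the vertices of \<open>Q T\<close> are affinely independent, and the coefficient of \<open>f\<close> in the
  expansion of any edge vector over \<open>T\<close> is the value of the functional on it. Semi-balancedness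
  provides a potential on the vertices that grows by \<open>1\<close> along every edge
  (\<open>semi_balanced_potential\<close>). Therefore those expansions are affine combinations, and every
  \<open>Q T\<close> has the affine hull of \<open>Q G\<close>.

  The rest depends on one fact about tours (\<open>no_return_across_bridge\<close>): after the tour of \<open>T\<close> has
  crossed the tree edge \<open>f\<close>, it can come back only over \<open>f\<close>, and then it has used both visits
  to \<open>f\<close> and stays. Hence a vertex visited between the crossing and some later visit to the far
  side lies on the far side as well.

  Disjointness (\<open>separating_cut\<close>). The tours of two Jaeger trees agree up to the first visit to an
  edge \<open>g\<close> that lies in only one of them, say in \<open>T\<close> and not in \<open>T'\<close>. As \<open>T'\<close> is a Jaeger
  tree, this visit is at the tail of \<open>g\<close>. Let \<open>S\<close> be the head side of \<open>g\<close> in \<open>T\<close>. An edge of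
  \<open>T'\<close> that enters \<open>S\<close> would be missing from \<open>T\<close>, so the tour of \<open>T\<close> would meet its tail before
  its head; by the fact on tours, it meets the tail before the tours part, and then \<open>T'\<close> would miss
  the edge too. So the indicator of \<open>S\<close> is nonpositive on \<open>Q T'\<close>, nonnegative on \<open>Q T\<close>, and
  positive at a vertex of \<open>Q T\<close>.

  Covering (\<open>exists_jaeger_tree_containing\<close>). Prefer to omit an edge that is visited at its tail and
  to keep an edge that is visited at its head, and order the spanning trees lexicographically by
  how well their tours follow this preference, earlier visits first. Given a point of \<open>Q G\<close>, let
  \<open>T\<close> be the best spanning tree whose simplex contains it. If the tour visited an edge \<open>e\<close> outside
  \<open>T\<close> first at its head, write the vector of \<open>e\<close> as an affine combination over \<open>T\<close> and move weight
  to \<open>e\<close> until an edge \<open>f\<close> with a positive coefficient has none left. The simplex of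
  \<open>T + e - f\<close> still contains the point. Of the two edges, the tour visits first either \<open>e\<close> at
  its head or, by the fact on tours, \<open>f\<close> at its tail; so \<open>T + e - f\<close> is better than \<open>T\<close>, which
  is absurd.
\<close>

section \<open>Cuts, bridges and trees\<close>

definition crosses :: "'v set \<Rightarrow> 'v \<times> 'v \<Rightarrow> bool" where
  "crosses S e \<longleftrightarrow> (fst e \<in> S) \<noteq> (snd e \<in> S)"

definition cut_connected :: "('v \<times> 'v) set \<Rightarrow> bool" where
  "cut_connected A \<longleftrightarrow> (\<forall>S. S \<noteq> {} \<longrightarrow> S \<noteq> UNIV \<longrightarrow> (\<exists>e\<in>A. crosses S e))"

text \<open>
  The cut is oriented: its indicator takes the value \<open>1\<close> on \<open>f\<close>, with no sign to carry along.
\<close>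

definition bridge_cut :: "('v \<times> 'v) set \<Rightarrow> 'v \<times> 'v \<Rightarrow> 'v set \<Rightarrow> bool" where
  "bridge_cut A f S \<longleftrightarrow> snd f \<in> S \<and> fst f \<notin> S \<and> (\<forall>g\<in>A. crosses S g \<longrightarrow> g = f)"

text \<open>
  These are the edge sets of the spanning trees on the whole type
  (\<open>spanning_tree_iff_cut_tree\<close>). In this form, tree exchanges and linear independence need no
  paths.
\<close>

definition cut_tree :: "('v \<times> 'v) set \<Rightarrow> bool" where
  "cut_tree A \<longleftrightarrow> cut_connected A \<and> (\<forall>f\<in>A. \<exists>S. bridge_cut A f S)"

lemma crosses_Compl [simp]: "crosses (- S) e \<longleftrightarrow> crosses S e"
  by (auto simp: crosses_def)

lemma crosses_swap [simp]: "crosses S (prod.swap e) \<longleftrightarrow> crosses S e"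
  by (auto simp: crosses_def)

lemma crosses_sym_diff: "crosses (sym_diff S R) e \<longleftrightarrow> crosses S e \<noteq> crosses R e"
  by (auto simp: crosses_def)

lemma bridge_cut_crosses: "bridge_cut A f S \<Longrightarrow> crosses S f"
  by (auto simp: bridge_cut_def crosses_def)

lemma bridge_cutI:
  assumes "crosses S f" and "\<And>g. g \<in> A \<Longrightarrow> crosses S g \<Longrightarrow> g = f"
  shows "\<exists>S. bridge_cut A f S"
proof (cases "snd f \<in> S")
  case True
  then have "bridge_cut A f S" using assms by (auto simp: bridge_cut_def crosses_def)
  then show ?thesis ..
next
  case False
  then have "bridge_cut A f (- S)" using assms by (auto simp: bridge_cut_def crosses_def)
  then show ?thesis ..
qed

lemma not_crosses_bridge_cut:
  "bridge_cut A f S \<Longrightarrow> g \<in> A \<Longrightarrow> g \<noteq> f \<Longrightarrow> fst g \<in> S \<longleftrightarrow> snd g \<in> S"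
  by (auto simp: bridge_cut_def crosses_def)

text \<open>
  Crossing is additive modulo \<open>2\<close> under symmetric difference of vertex sets. If no edge of the new
  set crossed \<open>R\<close>, then \<open>f\<close> would be the only edge of \<open>A\<close> to cross \<open>R\<close>, as it is for \<open>S\<close>, and the
  symmetric difference would be crossed by no edge of \<open>A\<close>; so \<open>R\<close> is \<open>S\<close> or its complement, but
  \<open>e\<close> crosses these. A cut that isolates another edge \<open>g\<close> in \<open>A\<close> isolates it in the new set too,
  after the symmetric difference with \<open>S\<close> if \<open>e\<close> crosses it.
\<close>

lemma cut_tree_exchange:
  assumes A: "cut_tree A" and f: "f \<in> A" and S: "bridge_cut A f S" and e: "crosses S e"
    and "e \<notin> A"
  shows "cut_tree (insert e A - {f})"
proof -
  let ?B = "insert e A - {f}"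
  have conn: "\<exists>g\<in>A. crosses R g" if "R \<noteq> {}" "R \<noteq> UNIV" for R
    using A that by (auto simp: cut_tree_def cut_connected_def)
  have only: "g = f" if "g \<in> A" "crosses S g" for g
    using that S by (auto simp: bridge_cut_def)
  have "cut_connected ?B"
    unfolding cut_connected_def
  proof (intro allI impI, rule ccontr)
    fix R assume R: "R \<noteq> {}" "R \<noteq> UNIV" and no: "\<not> (\<exists>g\<in>?B. crosses R g)"
    have "crosses R f" using conn[OF R] no by auto
    then have "\<not> crosses (sym_diff S R) g" if "g \<in> A" for g
      using that only[OF that] no bridge_cut_crosses[OF S] unfolding crosses_sym_diff by auto
    then have "sym_diff S R = {} \<or> sym_diff S R = UNIV" using conn[of "sym_diff S R"] by blast
    moreover have "R = S" if "sym_diff S R = {}" using that by blast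
    moreover have "R = - S" if "sym_diff S R = UNIV" using that by blast
    ultimately have "R = S \<or> R = - S" by blast
    then have "crosses R e" using e by auto
    with no \<open>e \<notin> A\<close> f show False by auto
  qed
  moreover have "\<exists>S. bridge_cut ?B g S" if g: "g \<in> ?B" for g
  proof (cases "g = e")
    case True
    then show ?thesis using e only by (intro bridge_cutI[of S]) auto
  next
    case False
    with g A obtain R where R: "bridge_cut A g R" by (auto simp: cut_tree_def)
    have onlyR: "g' = g" if "g' \<in> A" "crosses R g'" for g'
      using that R by (auto simp: bridge_cut_def)
    show ?thesis
    proof (cases "crosses R e")
      case True
      have "\<not> crosses S g" using only[of g] False g by auto
      moreover have "g' = g" if "g' \<in> ?B" "crosses S g' \<noteq> crosses R g'" for g'
        using that only[of g'] onlyR[of g'] e True by auto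
      ultimately show ?thesis
        using bridge_cut_crosses[OF R]
        by (intro bridge_cutI[of "sym_diff S R"]) (auto simp only: crosses_sym_diff)
    next
      case False
      then show ?thesis
        using onlyR bridge_cut_crosses[OF R] by (intro bridge_cutI[of R]) auto
    qed
  qed
  ultimately show ?thesis by (auto simp: cut_tree_def)
qed

lemma remove_non_bridge:
  assumes "cut_connected A" "\<not> (\<exists>S. bridge_cut A e S)"
  shows "cut_connected (A - {e})"
  unfolding cut_connected_def
proof (intro allI impI, rule ccontr)
  fix S assume S: "S \<noteq> {}" "S \<noteq> UNIV" and no: "\<not> (\<exists>f\<in>A - {e}. crosses S f)"
  then obtain f where "f \<in> A" "crosses S f" using assms(1) unfolding cut_connected_def by blast
  with no have "crosses S e" by auto
  then have "\<exists>S. bridge_cut A e S" using no by (intro bridge_cutI) auto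
  with assms(2) show False ..
qed

text \<open>
  Edges that are not bridges are deleted one by one.
\<close>

lemma exists_cut_tree:
  fixes A :: "('v::finite \<times> 'v) set"
  assumes "cut_connected A"
  obtains B where "B \<subseteq> A" "cut_tree B"
proof -
  have "\<exists>B\<subseteq>A. cut_tree B"
    using finite[of A] assms
  proof (induction A rule: finite_psubset_induct)
    case (psubset A)
    show ?case
    proof (cases "\<forall>e\<in>A. \<exists>S. bridge_cut A e S")
      case True
      with psubset.prems have "cut_tree A" by (auto simp: cut_tree_def)
      then show ?thesis by blast
    next
      case False
      then obtain e where e: "e \<in> A" "\<not> (\<exists>S. bridge_cut A e S)" by blast
      then have "A - {e} \<subset> A" "cut_connected (A - {e})"
        using remove_non_bridge[OF psubset.prems] by auto
      then show ?thesis using psubset.IH by (meson Diff_subset subset_trans)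
    qed
  qed
  then show ?thesis using that by blast
qed

section \<open>Paths, cycles and potentials\<close>

text \<open>
  The set of vertices reachable from \<open>u\<close> is crossed by no edge.
\<close>

lemma path_if_not_separated:
  fixes u v :: "'v::finite"
  assumes "\<And>S. u \<in> S \<Longrightarrow> v \<notin> S \<Longrightarrow> \<exists>e\<in>A. crosses S e"
  obtains p where "pcas u p v" "set p \<subseteq> A \<union> A\<inverse>" "distinct (pawalk_verts u p)"
proof -
  let ?H = "\<lparr>pverts = UNIV, parcs = A \<union> A\<inverse>\<rparr> :: 'v pair_pre_digraph"
  interpret pair_wf_digraph ?H by unfold_locales auto
  let ?S = "{w. reachable (with_proj ?H) u w}"
  have step: "w' \<in> ?S" if "w \<in> ?S" "(w, w') \<in> A \<union> A\<inverse>" for w w'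
    using that by (auto simp: reachable_def intro: rtrancl_on_into_rtrancl_on)
  have "v \<in> ?S"
  proof (rule ccontr)
    assume "v \<notin> ?S"
    moreover have "u \<in> ?S" by (simp add: reachable_def)
    ultimately obtain e where "e \<in> A" "crosses ?S e" using assms by blast
    then show False using step[of "fst e" "snd e"] step[of "snd e" "fst e"]
      unfolding crosses_def by (metis UnCI converse_iff prod.collapse)
  qed
  then obtain p where "apath u p v" using reachable_apath by blast
  then show ?thesis by (intro that) (auto simp: apath_def awalk_def)
qed

lemma walk_crosses:
  "pcas u p v \<Longrightarrow> (u \<in> S) \<noteq> (v \<in> S) \<Longrightarrow> \<exists>e\<in>set p. crosses S e"
  by (induction u p v rule: pcas.induct) (auto simp: crosses_def)

lemma pawalk_verts_eq: "pcas u p v \<Longrightarrow> pawalk_verts u p = map fst p @ [v]"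
  by (induction u p v rule: pcas.induct) auto

lemma parcs_mk_symmetric_with_proj:
  "parcs (mk_symmetric (with_proj G)) = parcs G \<union> (parcs G)\<inverse>"
  by (auto simp: parcs_mk_symmetric)

lemma underlying_cycle_iff:
  "pverts G = UNIV \<Longrightarrow>
   underlying_cycle G p \<longleftrightarrow> (\<exists>u. pcas u p u \<and> set p \<subseteq> parcs G \<union> (parcs G)\<inverse> \<and>
     distinct (tl (pawalk_verts u p))) \<and> 3 \<le> length p"
  by (auto simp: underlying_cycle_def pre_digraph.cycle_def pre_digraph.awalk_def
      cas_with_proj_eq awalk_verts_with_proj_eq parcs_mk_symmetric_with_proj)

lemma connected_iff_cut_connected:
  fixes G :: "'v::finite pair_pre_digraph"
  assumes "pverts G = UNIV"
  shows "Digraph_Component.connected (with_proj G) \<longleftrightarrow> cut_connected (parcs G)"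
proof
  interpret pair_wf_digraph "mk_symmetric (with_proj G)"
    by unfold_locales (auto simp: assms)
  {
    assume *: "Digraph_Component.connected (with_proj G)"
    show "cut_connected (parcs G)"
      unfolding cut_connected_def
    proof (intro allI impI)
      fix S :: "'v set" assume "S \<noteq> {}" "S \<noteq> UNIV"
      then obtain u v where uv: "u \<in> S" "v \<notin> S" by auto
      have "reachable (with_proj (mk_symmetric (with_proj G))) u v"
        using * assms by (auto simp: Digraph_Component.connected_def strongly_connected_def)
      then obtain p where "awalk u p v" using reachable_awalk by blast
      then have "pcas u p v" "set p \<subseteq> parcs G \<union> (parcs G)\<inverse>"
        by (auto simp: awalk_def parcs_mk_symmetric_with_proj)
      with walk_crosses[of u p v S] uv obtain e where "e \<in> parcs G \<union> (parcs G)\<inverse>" "crosses S e"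
        by blast
      then show "\<exists>e\<in>parcs G. crosses S e" by (force simp: crosses_def)
    qed
  next
    assume *: "cut_connected (parcs G)"
    show "Digraph_Component.connected (with_proj G)"
      unfolding Digraph_Component.connected_def strongly_connected_def
    proof (intro conjI ballI)
      fix u v
      have "\<exists>f\<in>parcs G. crosses S f" if "u \<in> S" "v \<notin> S" for S
        using * that by (auto simp: cut_connected_def)
      then obtain p where "pcas u p v" "set p \<subseteq> parcs G \<union> (parcs G)\<inverse>"
        by (rule path_if_not_separated)
      then have "awalk u p v" by (auto simp: awalk_def parcs_mk_symmetric_with_proj assms)
      then show "reachable (with_proj (mk_symmetric (with_proj G))) u v"
        using reachable_awalk by blast
    qed (simp add: assms)
  }
qed

text \<open>
  The length bound in \<open>underlying_cycle\<close> is met because no edge joins \<open>h\<close> to \<open>t\<close> in the opposite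
  direction, so that a path from \<open>h\<close> to \<open>t\<close> without \<open>(t, h)\<close> has at least two edges.
\<close>

lemma underlying_cycle_if_path:
  fixes G :: "'v::finite pair_pre_digraph"
  assumes G: "directed_graph G" and H: "pverts H = UNIV" "parcs H \<subseteq> parcs G"
    and e: "(t, h) \<in> parcs H" and p: "pcas h p t" "set p \<subseteq> A \<union> A\<inverse>" "distinct (pawalk_verts h p)"
    and A: "A \<subseteq> parcs H - {(t, h)}"
  shows "underlying_cycle H ((t, h) # p)"
proof -
  have "(h, t) \<notin> parcs H" using G H e by (metis directed_graph_def subsetD)
  moreover have "t \<noteq> h"
    using G subsetD[OF H(2) e] pair_loopfree_digraph.pair_no_loops[of G "(t, h)"]
    by (auto simp: directed_graph_def pair_digraph_def)
  ultimately have "2 \<le> length p" using p A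
    by (cases p; cases "tl p") (auto)
  then show ?thesis using p A e by (auto simp: underlying_cycle_iff[OF H(1)])
qed

text \<open>
  If \<open>f\<close> is not a bridge, then a path around it closes a cycle. Conversely, a cycle that starts with
  an edge joining \<open>u\<close> and \<open>v\<close> has to return across a cut that only this edge crosses; so it walks
  the edge twice, and having no repeated vertex it has length \<open>2\<close>.
\<close>

lemma acyclic_iff_bridges:
  fixes H :: "'v::finite pair_pre_digraph"
  assumes G: "directed_graph G" and H: "pverts H = UNIV" "parcs H \<subseteq> parcs G"
  shows "\<not> (\<exists>p. underlying_cycle H p) \<longleftrightarrow> (\<forall>f\<in>parcs H. \<exists>S. bridge_cut (parcs H) f S)"
proof
  assume acyc: "\<not> (\<exists>p. underlying_cycle H p)"
  show "\<forall>f\<in>parcs H. \<exists>S. bridge_cut (parcs H) f S"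
  proof (rule ballI, rule ccontr)
    fix f assume f: "f \<in> parcs H" and no: "\<not> (\<exists>S. bridge_cut (parcs H) f S)"
    obtain p where "pcas (snd f) p (fst f)"
      "set p \<subseteq> (parcs H - {f}) \<union> (parcs H - {f})\<inverse>" "distinct (pawalk_verts (snd f) p)"
      using path_if_not_separated[of "snd f" "fst f" "parcs H - {f}"] no
      unfolding bridge_cut_def by blast
    then have "underlying_cycle H ((fst f, snd f) # p)"
      using f by (intro underlying_cycle_if_path[OF G H, where A = "parcs H - {f}"]) auto
    with acyc show False by blast
  qed
next
  assume br: "\<forall>f\<in>parcs H. \<exists>S. bridge_cut (parcs H) f S"
  show "\<not> (\<exists>p. underlying_cycle H p)"
  proof
    assume "\<exists>p. underlying_cycle H p"
    then obtain u p where p: "pcas u p u" "set p \<subseteq> parcs H \<union> (parcs H)\<inverse>"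
      "distinct (tl (pawalk_verts u p))" "3 \<le> length p"
      by (auto simp: underlying_cycle_iff[OF H(1)])
    then obtain v q where pq: "p = (u, v) # q" by (cases p) auto
    with p have q: "pcas v q u" "2 \<le> length q" "distinct (map fst q @ [u])"
      "set q \<subseteq> parcs H \<union> (parcs H)\<inverse>"
      using pawalk_verts_eq[of v q u] by auto
    obtain f where f: "f \<in> parcs H" "f = (u, v) \<or> f = (v, u)" using p pq by auto
    with br obtain S where S: "bridge_cut (parcs H) f S" by blast
    with f have "(v \<in> S) \<noteq> (u \<in> S)" by (auto simp: bridge_cut_def)
    with walk_crosses[OF q(1)] obtain a where a: "a \<in> set q" "crosses S a" by blast
    from a q(4) have "a \<in> parcs H \<or> prod.swap a \<in> parcs H" by auto
    with S a(2) have "a = f \<or> prod.swap a = f" by (auto simp: bridge_cut_def)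
    with f(2) have "a = (u, v) \<or> a = (v, u)" by (cases a) auto
    moreover have "u \<notin> fst ` set q" using q(3) by auto
    ultimately have "(v, u) \<in> set q" using a by force
    obtain w q' where q': "q = (v, w) # q'" using q(1,2) by (cases q) auto
    with \<open>(v, u) \<in> set q\<close> q(3) have "w = u" by force
    with q q' \<open>u \<notin> fst ` set q\<close> show False by (cases q') auto
  qed
qed

lemma spanning_tree_iff_cut_tree:
  assumes "directed_graph G"
  shows "undirected_spanning_tree T G \<longleftrightarrow>
    pverts T = UNIV \<and> parcs T \<subseteq> parcs G \<and> cut_tree (parcs T)"
proof -
  have "wf_digraph (with_proj T)" if "pverts T = UNIV" using that by unfold_locales auto
  moreover have "wf_digraph (with_proj G)" using assms
    by (intro wf_digraph.intro) (auto simp: directed_graph_def)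
  ultimately have "spanning (with_proj T) (with_proj G) \<longleftrightarrow> pverts T = UNIV \<and> parcs T \<subseteq> parcs G"
    using assms by (auto simp: spanning_def subgraph_def compatible_def directed_graph_def)
  then show ?thesis
    using connected_iff_cut_connected[of T] acyclic_iff_bridges[OF assms, of T]
    by (auto simp: undirected_spanning_tree_def cut_tree_def)
qed

definition is_potential :: "('v \<Rightarrow> real) \<Rightarrow> ('v \<times> 'v) set \<Rightarrow> bool" where
  "is_potential l A \<longleftrightarrow> (\<forall>(t, h)\<in>A. l h - l t = 1)"

lemma potential_along_walk:
  assumes "is_potential l A" "A \<subseteq> E" "\<And>t h. (t, h) \<in> E \<Longrightarrow> (h, t) \<notin> E"
    and "pcas u p v" "set p \<subseteq> A \<union> A\<inverse>"
  shows "l v - l u = real (length (filter (\<lambda>(u, v). (u, v) \<in> E) p)) -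
    real (length (filter (\<lambda>(u, v). (v, u) \<in> E) p))"
  using assms(4,5)
proof (induction u p v rule: pcas.induct)
  case (2 u a es v)
  obtain w where a: "a = (u, w)" using "2.prems"(1) by (cases a) auto
  have IH: "l v - l w = real (length (filter (\<lambda>(u, v). (u, v) \<in> E) es)) -
    real (length (filter (\<lambda>(u, v). (v, u) \<in> E) es))" using "2.IH" "2.prems" a
    by (simp add: case_prod_unfold)
  from "2.prems" a consider "(u, w) \<in> A" | "(w, u) \<in> A" by auto
  then show ?case
  proof cases
    case 1
    then have "l w - l u = 1" "(u, w) \<in> E" "(w, u) \<notin> E" using assms(1-3)
      by (auto simp: is_potential_def)
    then show ?thesis using IH a by (simp add: case_prod_unfold)
  next
    case 2
    then have "l u - l w = 1" "(w, u) \<in> E" "(u, w) \<notin> E" using assms(1-3)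
      by (auto simp: is_potential_def)
    then show ?thesis using IH a by (simp add: case_prod_unfold)
  qed
qed simp

text \<open>
  The sum of the indicators of the head sides of all tree edges: along a tree edge \<open>g\<close> only the
  indicator that belongs to \<open>g\<close> changes.
\<close>

lemma tree_potential:
  fixes A :: "('v::finite \<times> 'v) set"
  assumes "cut_tree A"
  obtains l where "is_potential l A"
proof -
  obtain C where C: "\<And>f. f \<in> A \<Longrightarrow> bridge_cut A f (C f)"
    using assms by (metis cut_tree_def)
  define l where "l v = (\<Sum>f\<in>A. if v \<in> C f then 1 else 0 :: real)" for v
  have "l h - l t = 1" if "(t, h) \<in> A" for t h
  proof -
    have "l h - l t = (\<Sum>f\<in>A. (if h \<in> C f then 1 else 0) - (if t \<in> C f then 1 else 0))"
      by (simp add: l_def sum_subtractf)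
    also have "\<dots> = (\<Sum>f\<in>A. if f = (t, h) then 1 else 0)"
    proof (rule sum.cong[OF refl])
      fix f assume "f \<in> A"
      with C[OF this] not_crosses_bridge_cut[OF C[OF this] that]
      show "(if h \<in> C f then 1 else 0) - (if t \<in> C f then 1 else 0 :: real) =
        (if f = (t, h) then 1 else 0)"
        by (auto simp: bridge_cut_def)
    qed
    also have "\<dots> = 1" using that by simp
    finally show ?thesis .
  qed
  then show ?thesis by (intro that[of l]) (auto simp: is_potential_def)
qed

text \<open>
  A potential of a spanning tree also increases by \<open>1\<close> along an edge \<open>(t, h)\<close> outside the tree:
  the change along the tree path from \<open>h\<close> to \<open>t\<close> counts its forward minus its backward edges, and
  semi-balancedness of the cycle closed by \<open>(t, h)\<close> makes this difference \<open>-1\<close>.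
\<close>

lemma semi_balanced_potential:
  fixes G :: "'v::finite pair_pre_digraph"
  assumes G: "directed_graph G" "semi_balanced G" and A: "cut_tree A" "A \<subseteq> parcs G"
  obtains l where "is_potential l (parcs G)"
proof -
  obtain l where l: "is_potential l A" using tree_potential[OF A(1)] .
  have anti: "\<And>t h. (t, h) \<in> parcs G \<Longrightarrow> (h, t) \<notin> parcs G" and V: "pverts G = UNIV"
    using G by (auto simp: directed_graph_def)
  have "l h - l t = 1" if e: "(t, h) \<in> parcs G" for t h
  proof (cases "(t, h) \<in> A")
    case True
    then show ?thesis using l by (auto simp: is_potential_def)
  next
    case False
    have "\<exists>f\<in>A. crosses S f" if "h \<in> S" "t \<notin> S" for S
      using A(1) that by (auto simp: cut_tree_def cut_connected_def)
    then obtain p where p: "pcas h p t" "set p \<subseteq> A \<union> A\<inverse>" "distinct (pawalk_verts h p)"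
      by (rule path_if_not_separated)
    then have "underlying_cycle G ((t, h) # p)"
      using False e A by (intro underlying_cycle_if_path[OF G(1) V, where A = A]) auto
    with G(2) have "length (filter (\<lambda>(u, v). (u, v) \<in> parcs G) ((t, h) # p)) =
        length (filter (\<lambda>(u, v). (v, u) \<in> parcs G) ((t, h) # p))"
      unfolding semi_balanced_def by blast
    with e anti[OF e] have "Suc (length (filter (\<lambda>(u, v). (u, v) \<in> parcs G) p)) =
        length (filter (\<lambda>(u, v). (v, u) \<in> parcs G) p)" by simp
    with potential_along_walk[OF l A(2) anti p(1,2)] show ?thesis by linarith
  qed
  then show ?thesis by (intro that[of l]) (auto simp: is_potential_def)
qed

section \<open>Tours of spanning trees\<close>

lemma first_exit:
  fixes i j :: nat
  assumes "i \<le> j" "P i" "\<not> P j"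
  obtains l where "i \<le> l" "l < j" "P l" "\<not> P (Suc l)"
proof -
  have "\<exists>l\<ge>i. l < j \<and> P l \<and> \<not> P (Suc l)"
    using assms
  proof (induction j rule: dec_induct)
    case (step n)
    then show ?case by (cases "P n") (auto intro: less_SucI)
  qed simp
  then show ?thesis using that by blast
qed

text \<open>
  This gives both that the tour returns to its starting pair, the set of pairs being finite, and that
  it repeats no pair before its first return.
\<close>

lemma funpow_cancel_on:
  assumes "inj_on f D" "\<And>x. x \<in> D \<Longrightarrow> f x \<in> D" "x \<in> D" "(f ^^ (i + n)) x = (f ^^ i) x"
  shows "(f ^^ n) x = x"
  using assms(4)
proof (induction i)
  case (Suc i)
  have D: "(f ^^ m) x \<in> D" for m by (induction m) (auto simp: assms(2,3))
  have "f ((f ^^ (i + n)) x) = f ((f ^^ i) x)" using Suc.prems by simp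
  then have "(f ^^ (i + n)) x = (f ^^ i) x" using assms(1) D by (auto dest: inj_onD)
  then show ?case by (rule Suc.IH)
qed simp

lemma funpow_returns:
  assumes "inj_on f D" "\<And>x. x \<in> D \<Longrightarrow> f x \<in> D" "x \<in> D" "finite D"
  obtains n where "0 < n" "(f ^^ n) x = x"
proof -
  have D: "(f ^^ m) x \<in> D" for m by (induction m) (auto simp: assms(2,3))
  have "\<not> inj (\<lambda>i. (f ^^ i) x)"
    using finite_subset[OF _ assms(4), of "range (\<lambda>i. (f ^^ i) x)"] D
    by (auto dest: finite_imageD)
  then obtain i j where ij: "(f ^^ i) x = (f ^^ j) x" "i < j"
    unfolding inj_def by (metis linorder_neqE_nat)
  have "(f ^^ (j - i)) x = x"
    by (rule funpow_cancel_on[OF assms(1-3), where i = i]) (use ij in auto)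
  with ij(2) show ?thesis by (intro that[of "j - i"]) auto
qed

locale based_ribbon_graph =
  fixes G :: "'v::finite pair_pre_digraph"
    and \<rho> :: "'v \<Rightarrow> 'v \<times> 'v \<Rightarrow> 'v \<times> 'v"
    and b :: "'v \<times> ('v \<times> 'v)"
  assumes directed: "directed_graph G"
    and ribbon: "ribbon_structure G \<rho>"
    and basis: "snd b \<in> incident_edges G (fst b)"
begin

lemma incident_iff: "e \<in> incident_edges G x \<longleftrightarrow> e \<in> parcs G \<and> (fst e = x \<or> snd e = x)"
  by (auto simp: incident_edges_def in_arcs_def out_arcs_def)

lemma no_loop: "e \<in> parcs G \<Longrightarrow> fst e \<noteq> snd e"
  using directed pair_loopfree_digraph.pair_no_loops[of G e]
  by (auto simp: directed_graph_def pair_digraph_def)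

definition incident_pairs :: "('v \<times> ('v \<times> 'v)) set" where
  "incident_pairs = {(x, e). e \<in> incident_edges G x}"

lemma rotate_incident: "\<rho> x e \<in> incident_edges G x \<longleftrightarrow> e \<in> incident_edges G x"
  using ribbon permutes_in_image[of "\<rho> x" "incident_edges G x" e]
  by (auto simp: ribbon_structure_def)

lemma inj_rotate: "inj (\<rho> x)"
  using ribbon by (auto simp: ribbon_structure_def intro: permutes_inj)

lemma other_end_incident:
  "e \<in> incident_edges G x \<Longrightarrow> e \<in> incident_edges G (other_end x e)"
  by (auto simp: incident_iff other_end_def)

lemma other_end_inj:
  "e \<in> incident_edges G x \<Longrightarrow> e \<in> incident_edges G y \<Longrightarrow> other_end x e = other_end y e \<Longrightarrow> x = y"
  using no_loop[of e] by (auto simp: incident_iff other_end_def split: if_splits)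

lemma step_pairs: "p \<in> incident_pairs \<Longrightarrow> tour_step \<rho> T p \<in> incident_pairs"
  using rotate_incident other_end_incident by (cases p) (auto simp: incident_pairs_def)

lemma step_inj: "inj_on (tour_step \<rho> T) incident_pairs"
proof (rule inj_onI, clarify)
  fix x e y f
  assume *: "(x, e) \<in> incident_pairs" "(y, f) \<in> incident_pairs" "tour_step \<rho> T (x, e) = tour_step \<rho> T (y, f)"
  from * have "e = f"
    using inj_rotate by (auto simp: inj_eq split: if_splits)
  with * show "x = y \<and> e = f"
    using other_end_inj by (auto simp: incident_pairs_def split: if_splits)
qed

definition pos :: "'v pair_pre_digraph \<Rightarrow> nat \<Rightarrow> 'v \<times> ('v \<times> 'v)" where
  "pos T i = (tour_step \<rho> T ^^ i) b"

lemma pos_0 [simp]: "pos T 0 = b"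
  and pos_Suc: "pos T (Suc i) = tour_step \<rho> T (pos T i)"
  by (simp_all add: pos_def)

lemma basis_pairs: "b \<in> incident_pairs"
  using basis by (cases b) (simp add: incident_pairs_def)

lemma pos_pairs: "pos T i \<in> incident_pairs"
  by (induction i) (simp_all add: basis_pairs pos_Suc step_pairs)

lemma pos_incident: "snd (pos T i) \<in> incident_edges G (fst (pos T i))"
  using pos_pairs[of T i] by (auto simp: incident_pairs_def)

definition tour_length :: "'v pair_pre_digraph \<Rightarrow> nat" where
  "tour_length T = (LEAST n. 0 < n \<and> pos T n = b)"

lemma tour_length: "0 < tour_length T" "pos T (tour_length T) = b"
proof -
  obtain n where "0 < n \<and> pos T n = b"
    using funpow_returns[OF step_inj step_pairs basis_pairs] unfolding pos_def by auto
  then have "0 < tour_length T \<and> pos T (tour_length T) = b"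
    unfolding tour_length_def by (rule LeastI)
  then show "0 < tour_length T" "pos T (tour_length T) = b" by auto
qed

lemma pos_distinct:
  assumes "pos T i = pos T j" "i < tour_length T" "j < tour_length T"
  shows "i = j"
proof -
  have False if "pos T i = pos T j" "i < j" "j < tour_length T" for i j
  proof -
    have "pos T (j - i) = b"
      unfolding pos_def
      by (rule funpow_cancel_on[OF step_inj step_pairs basis_pairs, where i = i])
        (use that in \<open>auto simp: pos_def\<close>)
    then have "tour_length T \<le> j - i"
      unfolding tour_length_def by (rule Least_le[OF conjI, rotated]) (use that in simp)
    with that show False by linarith
  qed
  with assms show ?thesis by (metis linorder_neqE_nat)
qed

lemma pos_mod: "pos T (n mod tour_length T) = pos T n"
  using tour_length(2)[of T] unfolding pos_def by (rule funpow_mod_eq)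

lemma tour_length_le: "tour_length T \<le> CARD('v \<times> ('v \<times> 'v))"
proof -
  have "card (pos T ` {..<tour_length T}) = tour_length T"
    by (subst card_image) (auto intro!: inj_onI dest: pos_distinct)
  then show ?thesis by (metis card_mono finite subset_UNIV)
qed

lemma precedes_tour_iff:
  "precedes (tour \<rho> b T) p q \<longleftrightarrow>
     (\<exists>i j. i < j \<and> j < tour_length T \<and> pos T i = p \<and> pos T j = q)"
proof -
  have "tour \<rho> b T = map (pos T) [0..<tour_length T]"
    by (simp add: tour_def tour_length_def pos_def)
  then have len: "length (tour \<rho> b T) = tour_length T"
    and nth: "\<And>i. i < tour_length T \<Longrightarrow> tour \<rho> b T ! i = pos T i"
    by simp_all
  show ?thesis
    unfolding precedes_def len by (intro ex_cong1) (auto simp: nth)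
qed

lemma step_crosses:
  assumes "(fst (pos T i) \<in> S) \<noteq> (fst (pos T (Suc i)) \<in> S)"
  shows "snd (pos T i) \<in> parcs T" "crosses S (snd (pos T i))"
proof -
  obtain x e where p: "pos T i = (x, e)" by (metis prod.collapse)
  then have "fst (pos T (Suc i)) = (if e \<in> parcs T then other_end x e else x)"
    by (simp add: pos_Suc)
  with assms p have *: "e \<in> parcs T" "(x \<in> S) \<noteq> (other_end x e \<in> S)"
    by (metis fst_conv)+
  have "e \<in> incident_edges G x" using pos_incident[of T i] p by simp
  with *(2) have "crosses S e"
    by (auto simp: incident_iff other_end_def crosses_def split: if_splits)
  with *(1) p show "snd (pos T i) \<in> parcs T" "crosses S (snd (pos T i))" by simp_all
qed

lemma incident_side:
  "e \<in> incident_edges G x \<Longrightarrow> e \<in> incident_edges G y \<Longrightarrow> crosses S e \<Longrightarrow>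
   x \<in> S \<longleftrightarrow> y \<in> S \<Longrightarrow> x = y"
  by (auto simp: incident_iff crosses_def)

text \<open>
  If the tour were on the side \<open>S\<close> at time \<open>i\<close> and off it at time \<open>j\<close>, it would leave \<open>S\<close> in between,
  which is possible only from the pair \<open>(u, f)\<close>; but the tour has already used that pair at time
  \<open>k\<close>.
\<close>

lemma no_return_across_bridge:
  assumes only: "\<And>g. g \<in> parcs T \<Longrightarrow> crosses S g \<Longrightarrow> g = f"
    and k: "pos T k = (u, f)" "u \<in> S" and f: "crosses S f"
    and ij: "k < i" "i < j" "j < tour_length T" and j: "fst (pos T j) \<notin> S"
  shows "fst (pos T i) \<notin> S"
proof
  assume "fst (pos T i) \<in> S"
  with j ij obtain l where l: "i \<le> l" "l < j" "fst (pos T l) \<in> S" "fst (pos T (Suc l)) \<notin> S"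
    using first_exit[of i j "\<lambda>l. fst (pos T l) \<in> S"] by auto
  then have "snd (pos T l) = f" using step_crosses[of T l S] only by auto
  moreover from this have "fst (pos T l) = u"
    using pos_incident[of T l] pos_incident[of T k] k f l(3)
    by (auto intro: incident_side[of f])
  ultimately have "pos T l = pos T k" using k by (simp add: prod_eq_iff)
  then show False using pos_distinct[of T l k] l ij by linarith
qed

text \<open>
  If \<open>e\<close> is a tree edge, the tour crosses it from \<open>x\<close> and, being periodic, comes back to the side
  of \<open>x\<close>. It can do so only across \<open>e\<close>, and then the next pair is the successor of \<open>e\<close> at \<open>x\<close>.
\<close>

lemma rotate_visited:
  assumes T: "cut_tree (parcs T)" and i: "pos T i = (x, e)"
  shows "\<exists>j. pos T j = (x, \<rho> x e)"
proof (cases "e \<in> parcs T")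
  case False
  then have "pos T (Suc i) = (x, \<rho> x e)" using i by (simp add: pos_Suc)
  then show ?thesis ..
next
  case True
  then obtain S where S: "bridge_cut (parcs T) e S" using T by (auto simp: cut_tree_def)
  note cr = bridge_cut_crosses[OF S]
  let ?y = "other_end x e"
  have inc: "e \<in> incident_edges G x" using pos_incident[of T i] i by simp
  have y: "(?y \<in> S) \<noteq> (x \<in> S)" and yx: "other_end ?y e = x"
    using cr inc by (auto simp: other_end_def crosses_def incident_iff)
  have "fst (pos T (Suc i)) = ?y" using True i by (simp add: pos_Suc)
  moreover have per: "pos T (i + tour_length T) = (x, e)"
    using i pos_mod[of T "i + tour_length T"] pos_mod[of T i] by simp
  moreover have "Suc i \<le> i + tour_length T" using tour_length(1)[of T] by simp
  ultimately obtain l where l: "(fst (pos T l) \<in> S) \<noteq> (x \<in> S)" "\<not> (fst (pos T (Suc l)) \<in> S) \<noteq> (x \<in> S)"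
    using first_exit[of "Suc i" "i + tour_length T" "\<lambda>l. (fst (pos T l) \<in> S) \<noteq> (x \<in> S)"] y
    by (metis fst_conv)
  then have "(fst (pos T l) \<in> S) \<noteq> (fst (pos T (Suc l)) \<in> S)" by auto
  from step_crosses[OF this] S have e: "snd (pos T l) = e" by (auto simp: bridge_cut_def)
  have "e \<in> incident_edges G (fst (pos T l))" using pos_incident[of T l] e by simp
  then have "fst (pos T l) = ?y"
    using incident_side[OF _ other_end_incident[OF inc] cr, of "fst (pos T l)"] l(1) y by blast
  with e have "pos T l = (?y, e)" by (simp add: prod_eq_iff)
  with True yx have "pos T (Suc l) = (x, \<rho> x e)" by (simp add: pos_Suc)
  then show ?thesis ..
qed

lemma incident_visited:
  assumes T: "cut_tree (parcs T)" and i: "pos T i = (x, e)" and f: "f \<in> incident_edges G x"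
  shows "\<exists>j. pos T j = (x, f)"
proof -
  have e: "e \<in> incident_edges G x" using pos_incident[of T i] i by simp
  then have "cyclic_on (\<rho> x) (incident_edges G x)"
    using ribbon by (auto simp: ribbon_structure_def)
  with e f have "f \<in> orbit (\<rho> x) e" by (metis orbit_cyclic_eq3)
  then show ?thesis
    by induction (use rotate_visited[OF T] i in blast)+
qed

text \<open>
  All edges at a visited vertex are visited, hence also all its neighbours in the tree.
\<close>

lemma tour_visits_all:
  assumes T: "cut_tree (parcs T)" "parcs T \<subseteq> parcs G" and e: "e \<in> incident_edges G x"
  obtains i where "i < tour_length T" "pos T i = (x, e)"
proof -
  let ?X = "range (\<lambda>i. fst (pos T i))"
  have closed: "other_end y f \<in> ?X" if "y \<in> ?X" "f \<in> parcs T" "fst f = y \<or> snd f = y" for y f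
  proof -
    from that(1) obtain i where "fst (pos T i) = y" by blast
    then have "pos T i = (y, snd (pos T i))" by (simp add: prod_eq_iff)
    moreover have "f \<in> incident_edges G y" using that T by (auto simp: incident_iff)
    ultimately obtain j where "pos T j = (y, f)" using incident_visited[OF T(1)] by blast
    with that(2) have "fst (pos T (Suc j)) = other_end y f" by (simp add: pos_Suc)
    then show ?thesis by (rule range_eqI[OF sym])
  qed
  have "?X = UNIV"
  proof (rule ccontr)
    assume "?X \<noteq> UNIV"
    moreover have "?X \<noteq> {}" by simp
    ultimately obtain f where f: "f \<in> parcs T" "crosses ?X f"
      using T(1) unfolding cut_tree_def cut_connected_def by blast
    have "fst f \<noteq> snd f" using f(1) T(2) no_loop by blast
    then have "other_end (fst f) f = snd f" "other_end (snd f) f = fst f"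
      by (simp_all add: other_end_def)
    then show False
      using closed[of "fst f" f] closed[of "snd f" f] f unfolding crosses_def by metis
  qed
  then obtain i where "fst (pos T i) = x" by (metis UNIV_I imageE)
  then have "pos T i = (x, snd (pos T i))" by (simp add: prod_eq_iff)
  then obtain j where "pos T j = (x, e)" using incident_visited[OF T(1)] e by blast
  then have "pos T (j mod tour_length T) = (x, e)" by (simp add: pos_mod)
  moreover have "j mod tour_length T < tour_length T" using tour_length(1) by simp
  ultimately show ?thesis using that by blast
qed

text \<open>
  A tour depends on the tree only through the membership of the edges visited so far.
\<close>

lemma pos_agree:
  assumes "\<And>i. i < k \<Longrightarrow> snd (pos T i) \<in> parcs T \<longleftrightarrow> snd (pos T i) \<in> parcs T'" and "i \<le> k"
  shows "pos T i = pos T' i"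
  using assms(2)
proof (induction i)
  case (Suc i)
  then have "pos T i = pos T' i" by simp
  with assms(1)[of i] Suc.prems show ?case by (cases "pos T' i") (auto simp: pos_Suc)
qed simp

text \<open>
  A visit scores \<open>1\<close> if it follows the rule of omitting an edge visited at its tail and keeping an
  edge visited at its head. The scores of the first \<open>n\<close> visits are read as the digits of a binary
  number, so that comparing these numbers is comparing the sequences lexicographically.
\<close>

definition digit :: "'v pair_pre_digraph \<Rightarrow> nat \<Rightarrow> nat" where
  "digit T i = (if (fst (pos T i) = fst (snd (pos T i))) = (snd (pos T i) \<notin> parcs T) then 1 else 0)"

primrec score :: "'v pair_pre_digraph \<Rightarrow> nat \<Rightarrow> nat" where
  "score T 0 = 0"
| "score T (Suc n) = 2 * score T n + digit T n"

lemma score_less: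
  assumes "\<And>i. i < k \<Longrightarrow> snd (pos T i) \<in> parcs T \<longleftrightarrow> snd (pos T i) \<in> parcs T'"
    and "digit T k < digit T' k" and "k < n"
  shows "score T n < score T' n"
proof -
  have eq: "digit T i = digit T' i" if "i < k" for i
    using pos_agree[OF assms(1), of k i] assms(1)[OF that] that by (auto simp: digit_def)
  have "score T i = score T' i" if "i \<le> k" for i
    using that by (induction i) (auto simp: eq)
  moreover have "digit T i \<le> 1" for T i by (simp add: digit_def)
  ultimately show ?thesis using \<open>k < n\<close>
  proof (induction n)
    case (Suc n)
    show ?case
    proof (cases "n = k")
      case True
      then show ?thesis using Suc assms(2) by simp
    next
      case False
      then have "score T n < score T' n" using Suc by simp
      then show ?thesis using Suc(3)[of T n] by simp
    qed
  qed simp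
qed

text \<open>
  The two tours coincide until \<open>(t, h)\<close> or \<open>f\<close> is visited. If this is \<open>(t, h)\<close>, then the visit is
  at \<open>h\<close> by the violation, and including the edge gains the digit. If it is \<open>f\<close>, then the visit is
  at its tail, and removing \<open>f\<close> gains the digit: a visit at its head would take the tour out of \<open>S\<close>,
  and since it reaches \<open>t\<close> outside \<open>S\<close> later than \<open>h\<close>, the vertex \<open>h\<close> would lie outside \<open>S\<close> as well.
\<close>

lemma exchange_improves_score:
  assumes T: "cut_tree (parcs T)" "parcs T \<subseteq> parcs G"
    and e: "(t, h) \<in> parcs G - parcs T"
    and viol: "\<not> precedes (tour \<rho> b T) (t, (t, h)) (h, (t, h))"
    and f: "f \<in> parcs T" and S: "bridge_cut (parcs T) f S" and side: "h \<in> S" "t \<notin> S"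
    and T': "parcs T' = insert (t, h) (parcs T) - {f}"
    and n: "tour_length T \<le> n"
  shows "score T n < score T' n"
proof -
  let ?e = "(t, h)"
  have "t \<noteq> h" using side by auto
  have "?e \<noteq> f" using e f by auto
  have "?e \<in> incident_edges G h" "?e \<in> incident_edges G t" using e by (auto simp: incident_iff)
  then obtain i j where i: "i < tour_length T" "pos T i = (h, ?e)"
    and j: "j < tour_length T" "pos T j = (t, ?e)"
    using tour_visits_all[OF T] by metis
  then have "i < j" using viol \<open>t \<noteq> h\<close> unfolding precedes_tour_iff
    by (metis Pair_inject linorder_neqE_nat)
  define k where "k = (LEAST k. snd (pos T k) \<in> {?e, f})"
  have k: "snd (pos T k) \<in> {?e, f}" unfolding k_def by (rule LeastI[of _ i]) (simp add: i)
  have "k \<le> i" unfolding k_def by (rule Least_le) (simp add: i)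
  have before: "snd (pos T l) \<notin> {?e, f}" if "l < k" for l
    using not_less_Least[of l] that unfolding k_def by blast
  have agree: "snd (pos T l) \<in> parcs T \<longleftrightarrow> snd (pos T l) \<in> parcs T'" if "l < k" for l
    using before[OF that] by (auto simp: T')
  have pk: "pos T' k = pos T k" using pos_agree[OF agree, of k k] by simp
  have "fst (pos T k) = h" if "snd (pos T k) = ?e"
  proof (rule ccontr)
    assume "fst (pos T k) \<noteq> h"
    then have "pos T k = pos T j"
      using that pos_incident[of T k] j by (auto simp: incident_iff prod_eq_iff)
    then show False using pos_distinct[of T k j] j \<open>k \<le> i\<close> \<open>i < j\<close> by linarith
  qed
  moreover have "fst (pos T k) = fst f" if "snd (pos T k) = f"
  proof (rule ccontr)
    assume "fst (pos T k) \<noteq> fst f"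
    then have "pos T k = (snd f, f)"
      using that pos_incident[of T k] by (auto simp: incident_iff prod_eq_iff)
    moreover have "k < i" using \<open>k \<le> i\<close> that i \<open>?e \<noteq> f\<close> by (cases "k = i") auto
    ultimately have "fst (pos T i) \<notin> S"
      using no_return_across_bridge[of T S f k "snd f" i j] S \<open>i < j\<close> j side
        bridge_cut_crosses[OF S] by (auto simp: bridge_cut_def)
    then show False using i side by simp
  qed
  ultimately have "digit T k < digit T' k"
    using k e f \<open>t \<noteq> h\<close> \<open>?e \<noteq> f\<close> by (auto simp: digit_def pk T')
  then show ?thesis using score_less[OF agree] \<open>k \<le> i\<close> i(1) n by force
qed

definition jaeger_condition :: "'v pair_pre_digraph \<Rightarrow> bool" where
  "jaeger_condition T \<longleftrightarrow> (\<forall>t h. (t, h) \<in> parcs G - parcs T \<longrightarrow>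
        precedes (tour \<rho> b T) (t, (t, h)) (h, (t, h)))"

text \<open>
  The tours part at time \<open>k\<close>, at an edge \<open>g\<close> of \<open>T\<close> only; \<open>S\<close> is the head side of \<open>g\<close> in \<open>T\<close>.
\<close>

lemma separating_cut_at_first_difference:
  assumes T: "cut_tree (parcs T)" "parcs T \<subseteq> parcs G" "jaeger_condition T"
    and T': "parcs T' \<subseteq> parcs G" "jaeger_condition T'"
    and before: "\<And>i. i < k \<Longrightarrow> snd (pos T i) \<in> parcs T \<longleftrightarrow> snd (pos T i) \<in> parcs T'"
    and k: "snd (pos T k) \<in> parcs T - parcs T'"
  shows "\<exists>g S. g \<in> parcs T \<and> bridge_cut (parcs T) g S \<and> (\<forall>f\<in>parcs T'. snd f \<in> S \<longrightarrow> fst f \<in> S)"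
proof -
  define g where "g = snd (pos T k)"
  have g: "g \<in> parcs T" "g \<notin> parcs T'" using k by (auto simp: g_def)
  obtain S where S: "bridge_cut (parcs T) g S" using T(1) g by (auto simp: cut_tree_def)
  have agree: "pos T i = pos T' i" if "i \<le> k" for i using pos_agree[OF before that] .
  \<comment> \<open>\<open>g\<close> is visited at its tail, because \<open>T'\<close> omits it and is a Jaeger tree.\<close>
  have tail: "pos T k = (fst g, g)"
  proof (rule ccontr)
    assume "pos T k \<noteq> (fst g, g)"
    then have pk: "pos T k = (snd g, g)"
      using pos_incident[of T k] by (auto simp: incident_iff prod_eq_iff g_def)
    have "(fst g, snd g) \<in> parcs G - parcs T'" using g T(2) by auto
    then obtain i j where ij: "i < j" "j < tour_length T'" "pos T' i = (fst g, g)" "pos T' j = (snd g, g)"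
      using T'(2) unfolding jaeger_condition_def precedes_tour_iff by (metis prod.collapse)
    show False
    proof (cases "k < j")
      case True
      then show False using pos_distinct[of T' k j] ij agree[of k] pk by auto
    next
      case False
      then show False using before[of i] agree[of i] ij g by auto
    qed
  qed
  have "fst f \<in> S" if f: "f \<in> parcs T'" "snd f \<in> S" for f
  proof (rule ccontr)
    assume "fst f \<notin> S"
    with f(2) have "crosses S f" by (auto simp: crosses_def)
    moreover have "f \<noteq> g" using f g by auto
    ultimately have "f \<notin> parcs T" using S by (auto simp: bridge_cut_def)
    with f T'(1) have "(fst f, snd f) \<in> parcs G - parcs T" by auto
    then obtain i j where ij: "i < j" "j < tour_length T" "pos T i = (fst f, f)" "pos T j = (snd f, f)"
      using T(3) unfolding jaeger_condition_def precedes_tour_iff by (metis prod.collapse)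
    consider "i < k" | "i = k" | "k < i" by linarith
    then show False
    proof cases
      case 1
      with before[of i] ij f \<open>f \<notin> parcs T\<close> show False by auto
    next
      case 2
      with ij tail \<open>f \<noteq> g\<close> show False by auto
    next
      case 3
      \<comment> \<open>The tour crosses \<open>g\<close> from its tail, so the side it leaves is the complement of \<open>S\<close>.\<close>
      have "fst (pos T i) \<notin> - S"
        using no_return_across_bridge[of T "- S" g k "fst g" i j] S tail 3 ij f
          bridge_cut_crosses[OF S] by (auto simp: bridge_cut_def)
      with ij \<open>fst f \<notin> S\<close> show False by simp
    qed
  qed
  with g S show ?thesis by blast
qed

lemma separating_cut:
  assumes T: "cut_tree (parcs T)" "parcs T \<subseteq> parcs G" "jaeger_condition T"
    and T': "cut_tree (parcs T')" "parcs T' \<subseteq> parcs G" "jaeger_condition T'"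
    and ne: "parcs T \<noteq> parcs T'"
  shows "(\<exists>g S. g \<in> parcs T \<and> bridge_cut (parcs T) g S \<and>
            (\<forall>f\<in>parcs T'. snd f \<in> S \<longrightarrow> fst f \<in> S)) \<or>
         (\<exists>g S. g \<in> parcs T' \<and> bridge_cut (parcs T') g S \<and>
            (\<forall>f\<in>parcs T. snd f \<in> S \<longrightarrow> fst f \<in> S))"
proof -
  let ?D = "sym_diff (parcs T) (parcs T')"
  obtain e where e: "e \<in> ?D" using ne by blast
  then have "e \<in> incident_edges G (fst e)" using T T' by (auto simp: incident_iff)
  then obtain i where "pos T i = (fst e, e)" using tour_visits_all[OF T(1,2)] by blast
  then have "snd (pos T i) = e" by simp
  with e have i: "snd (pos T i) \<in> ?D" by blast
  define k where "k = (LEAST k. snd (pos T k) \<in> ?D)"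
  have k: "snd (pos T k) \<in> ?D"
    unfolding k_def using i by (rule LeastI[where P = "\<lambda>k. snd (pos T k) \<in> ?D"])
  have before: "snd (pos T l) \<in> parcs T \<longleftrightarrow> snd (pos T l) \<in> parcs T'" if "l < k" for l
    using not_less_Least[of l] that unfolding k_def by blast
  have agree: "pos T i = pos T' i" if "i \<le> k" for i using pos_agree[OF before that] .
  from k consider "snd (pos T k) \<in> parcs T - parcs T'" | "snd (pos T' k) \<in> parcs T' - parcs T"
    unfolding agree[of k, OF order_refl] by blast
  then show ?thesis
  proof cases
    case 1
    then show ?thesis using separating_cut_at_first_difference[OF T T'(2,3) before] by blast
  next
    case 2
    have "snd (pos T' l) \<in> parcs T' \<longleftrightarrow> snd (pos T' l) \<in> parcs T" if "l < k" for l
      using before[OF that] agree[of l] that by simp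
    then show ?thesis using separating_cut_at_first_difference[OF T' T(2,3) _ 2] by blast
  qed
qed

end

section \<open>Edge vectors and exchange in convex hulls\<close>

definition edge_vec :: "'v \<times> 'v \<Rightarrow> real ^ 'v::finite" where
  "edge_vec e = axis (snd e) 1 - axis (fst e) 1"

definition cut_vec :: "'v set \<Rightarrow> real ^ 'v::finite" where
  "cut_vec S = (\<chi> v. if v \<in> S then 1 else 0)"

lemma inner_edge_vec: "y \<bullet> edge_vec e = y $ snd e - y $ fst e"
  by (simp add: edge_vec_def inner_diff_right inner_axis)

lemma cut_vec_edge_vec:
  "cut_vec S \<bullet> edge_vec e = (if snd e \<in> S then 1 else 0) - (if fst e \<in> S then 1 else 0)"
  by (simp add: inner_edge_vec cut_vec_def)

lemma cut_vec_bridge: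
  assumes "bridge_cut A f S" "g \<in> A"
  shows "cut_vec S \<bullet> edge_vec g = (if g = f then 1 else 0)"
  using not_crosses_bridge_cut[OF assms] assms(1) by (auto simp: cut_vec_edge_vec bridge_cut_def)

lemma potential_edge_vec: "is_potential l A \<Longrightarrow> e \<in> A \<Longrightarrow> (\<chi> v. l v) \<bullet> edge_vec e = 1"
  by (auto simp: is_potential_def inner_edge_vec)

lemma root_polytope_eq: "root_polytope H = convex hull (edge_vec ` parcs H)"
  by (simp add: root_polytope_def edge_vec_def case_prod_unfold)

lemma inj_on_edge_vec:
  assumes "\<And>e. e \<in> A \<Longrightarrow> fst e \<noteq> snd e"
  shows "inj_on edge_vec A"
proof (rule inj_onI)
  fix e f assume ef: "e \<in> A" "f \<in> A" "edge_vec e = edge_vec f"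
  have "edge_vec e $ v = edge_vec f $ v" for v using ef(3) by simp
  from this[of "fst e"] this[of "snd e"] assms[OF ef(1)] assms[OF ef(2)] show "e = f"
    by (auto simp: edge_vec_def axis_def prod_eq_iff split: if_splits)
qed

lemma loopfree_potential: "is_potential l A \<Longrightarrow> e \<in> A \<Longrightarrow> fst e \<noteq> snd e"
  by (auto simp: is_potential_def)

text \<open>
  Weights are put on edges instead of vectors, so that edges can be exchanged without translating
  back and forth.
\<close>

lemma in_convex_hull_image_iff:
  assumes "finite A" "inj_on v A"
  shows "x \<in> convex hull (v ` A) \<longleftrightarrow>
    (\<exists>u. (\<forall>a\<in>A. 0 \<le> u a) \<and> sum u A = 1 \<and> (\<Sum>a\<in>A. u a *\<^sub>R v a) = (x :: 'b::real_vector))"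
    (is "?L \<longleftrightarrow> ?R")
proof
  assume ?L
  then obtain u where u: "\<forall>y\<in>v ` A. 0 \<le> u y" "sum u (v ` A) = 1" "(\<Sum>y\<in>v ` A. u y *\<^sub>R y) = x"
    using assms(1) by (auto simp: convex_hull_finite)
  then show ?R using assms(2)
    by (intro exI[of _ "u \<circ> v"]) (auto simp: sum.reindex o_def)
next
  assume ?R
  then obtain u where u: "\<forall>a\<in>A. 0 \<le> u a" "sum u A = 1" "(\<Sum>a\<in>A. u a *\<^sub>R v a) = x" by blast
  have "(\<Sum>a\<in>A. u a *\<^sub>R v a) \<in> convex hull (v ` A)"
    using assms(1) u by (intro convex_sum convex_convex_hull) (auto intro: hull_inc)
  with u(3) show ?L by simp
qed

text \<open>
  Weight moves from \<open>A\<close> to \<open>e\<close> along the relation \<open>v e = (\<Sum>a\<in>A. c a *\<^sub>R v a)\<close>, by the largest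
  amount \<open>r\<close> that keeps all weights nonnegative; it is limited by the elements with \<open>c a > 0\<close>, which
  exist since the coefficients sum to \<open>1\<close>.
\<close>

lemma convex_hull_exchange:
  fixes v :: "'a \<Rightarrow> 'b::real_vector"
  assumes A: "finite A" "e \<notin> A" "inj_on v (insert e A)"
    and c: "v e = (\<Sum>a\<in>A. c a *\<^sub>R v a)" "sum c A = (1::real)"
    and x: "x \<in> convex hull (v ` insert e A)"
  obtains f where "f \<in> A" "c f > 0" "x \<in> convex hull (v ` (insert e A - {f}))"
proof -
  obtain m where m: "\<And>a. a \<in> insert e A \<Longrightarrow> 0 \<le> m a" "sum m (insert e A) = 1"
    "(\<Sum>a\<in>insert e A. m a *\<^sub>R v a) = x"
    using x in_convex_hull_image_iff[of "insert e A" v x] A by auto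
  let ?P = "{a \<in> A. c a > 0}"
  have "?P \<noteq> {}"
  proof
    assume "?P = {}"
    then have "sum c A \<le> 0" by (intro sum_nonpos) (auto simp: not_less)
    with c(2) show False by simp
  qed
  define f where "f = arg_min_on (\<lambda>a. m a / c a) ?P"
  have f: "f \<in> ?P" "\<And>a. a \<in> ?P \<Longrightarrow> m f / c f \<le> m a / c a"
    unfolding f_def using \<open>?P \<noteq> {}\<close> A(1)
    by (intro arg_min_if_finite arg_min_least; simp)+
  define r where "r = m f / c f"
  have "0 \<le> r" using f(1) m(1)[of f] by (simp add: r_def)
  define m' where "m' a = (if a = e then m e + r else m a - r * c a)" for a
  have "f \<noteq> e" using f(1) A(2) by auto
  have "m' f = 0" using f(1) \<open>f \<noteq> e\<close> by (simp add: m'_def r_def)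
  have m'A: "m' a = m a - r * c a" if "a \<in> A" for a using that A(2) by (auto simp: m'_def)
  have nonneg: "0 \<le> m' a" if a: "a \<in> insert e A" for a
  proof (cases "a = e")
    case True
    then show ?thesis using m(1)[OF a] \<open>0 \<le> r\<close> by (simp add: m'_def)
  next
    case False
    show ?thesis
    proof (cases "c a > 0")
      case True
      then have "r \<le> m a / c a" using f(2)[of a] a False by (simp add: r_def)
      with True False show ?thesis by (simp add: m'_def field_simps)
    next
      case False
      then have "r * c a \<le> 0" using \<open>0 \<le> r\<close> by (simp add: mult_nonneg_nonpos not_less)
      then show ?thesis using m(1)[OF a] \<open>a \<noteq> e\<close> by (simp add: m'_def)
    qed
  qed
  have "(\<Sum>a\<in>insert e A. m' a) = m e + r + (\<Sum>a\<in>A. m a - r * c a)"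
    using A by (simp add: m'A) (simp add: m'_def)
  also have "\<dots> = 1" using m(2) A c(2) by (simp add: sum_subtractf flip: sum_distrib_left)
  finally have sum1: "(\<Sum>a\<in>insert e A. m' a) = 1" .
  have "(\<Sum>a\<in>insert e A. m' a *\<^sub>R v a) = (m e + r) *\<^sub>R v e + (\<Sum>a\<in>A. (m a - r * c a) *\<^sub>R v a)"
    using A by (simp add: m'A) (simp add: m'_def)
  also have "\<dots> = (m e + r) *\<^sub>R v e + ((\<Sum>a\<in>A. m a *\<^sub>R v a) - r *\<^sub>R v e)"
    unfolding c(1) by (simp add: scaleR_diff_left sum_subtractf scaleR_sum_right)
  also have "\<dots> = x" using m(3) A by (simp add: algebra_simps)
  finally have comb: "(\<Sum>a\<in>insert e A. m' a *\<^sub>R v a) = x" .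
  let ?B = "insert e A - {f}"
  have "sum m' ?B = 1" "(\<Sum>a\<in>?B. m' a *\<^sub>R v a) = x"
    using sum1 comb A(1) f(1) \<open>m' f = 0\<close>
    by (simp_all add: sum.remove[of "insert e A" f])
  moreover have "inj_on v ?B" using A(3) by (rule inj_on_subset) auto
  ultimately have "x \<in> convex hull (v ` ?B)"
    using in_convex_hull_image_iff[of ?B v x] A(1) nonneg by auto
  with f(1) that show ?thesis by auto
qed

lemma edge_vec_in_span:
  assumes "cut_connected A"
  shows "edge_vec e \<in> span (edge_vec ` A)"
proof -
  let ?X = "{v. axis v 1 - axis (fst e) 1 \<in> span (edge_vec ` A)}"
  have "?X = UNIV"
  proof (rule ccontr)
    assume "?X \<noteq> UNIV"
    moreover have "fst e \<in> ?X" by (simp add: span_zero)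
    ultimately obtain f where f: "f \<in> A" "crosses ?X f"
      using assms unfolding cut_connected_def by (metis (no_types, lifting) empty_iff)
    have "edge_vec f \<in> span (edge_vec ` A)" using f by (intro span_base) auto
    from f(2) span_add[OF _ this] span_diff[OF _ this] show False
      by (fastforce simp: crosses_def edge_vec_def)
  qed
  then show ?thesis by (auto simp: edge_vec_def)
qed

text \<open>
  The combination exists because connectedness links the two ends of \<open>e\<close> by edges of \<open>A\<close>; it is
  affine because the linear functional of the potential is \<open>1\<close> on every edge vector.
\<close>

lemma edge_vec_affine_combination:
  assumes A: "cut_connected A" and l: "is_potential l (insert e A)"
  obtains c where "edge_vec e = (\<Sum>a\<in>A. c a *\<^sub>R edge_vec a)" "sum c A = 1"
proof -
  have inj: "inj_on edge_vec A" using loopfree_potential[OF l] by (intro inj_on_edge_vec) auto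
  obtain u where "edge_vec e = (\<Sum>y\<in>edge_vec ` A. u y *\<^sub>R y)"
    using edge_vec_in_span[OF A, of e] by (auto simp: span_finite)
  then have c: "edge_vec e = (\<Sum>a\<in>A. u (edge_vec a) *\<^sub>R edge_vec a)"
    using inj by (simp add: sum.reindex)
  have "(\<chi> v. l v) \<bullet> edge_vec e = (\<Sum>a\<in>A. u (edge_vec a) * ((\<chi> v. l v) \<bullet> edge_vec a))"
    by (subst c) (simp add: inner_sum_right)
  then have "(\<Sum>a\<in>A. u (edge_vec a)) = 1" using potential_edge_vec[OF l] by simp
  with c show ?thesis by (intro that[of "\<lambda>a. u (edge_vec a)"])
qed

text \<open>
  For an edge \<open>e\<close> outside a tree, the coefficient of \<open>f\<close> is therefore nonzero exactly on the
  fundamental cycle of \<open>e\<close>, and positive if \<open>f\<close> separates the ends of \<open>e\<close> with the same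
  orientation.
\<close>

lemma bridge_coefficient:
  assumes "edge_vec e = (\<Sum>a\<in>A. c a *\<^sub>R edge_vec a)" "f \<in> A" "bridge_cut A f S"
  shows "c f = cut_vec S \<bullet> edge_vec e"
proof -
  have "cut_vec S \<bullet> edge_vec e = (\<Sum>a\<in>A. c a * (cut_vec S \<bullet> edge_vec a))"
    by (subst assms(1)) (simp add: inner_sum_right)
  also have "\<dots> = (\<Sum>a\<in>A. if a = f then c f else 0)"
    by (rule sum.cong) (auto simp: cut_vec_bridge[OF assms(3)])
  also have "\<dots> = c f" using assms(2) by simp
  finally show ?thesis by simp
qed

text \<open>
  While some edge \<open>e\<close> is not a bridge, the exchange of \<open>e\<close> into the remaining edges empties another
  edge \<open>f\<close> with a nonzero coefficient. By \<open>bridge_coefficient\<close>, \<open>f\<close> is not a bridge either, so it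
  can be deleted.
\<close>

lemma exists_cut_tree_containing:
  fixes A :: "('v::finite \<times> 'v) set"
  assumes "cut_connected A" "is_potential l A" "x \<in> convex hull (edge_vec ` A)"
  obtains B where "B \<subseteq> A" "cut_tree B" "x \<in> convex hull (edge_vec ` B)"
proof -
  have "\<exists>B\<subseteq>A. cut_tree B \<and> x \<in> convex hull (edge_vec ` B)"
    using finite[of A] assms
  proof (induction A rule: finite_psubset_induct)
    case (psubset A)
    show ?case
    proof (cases "\<forall>e\<in>A. \<exists>S. bridge_cut A e S")
      case True
      with psubset.prems have "cut_tree A" by (auto simp: cut_tree_def)
      with psubset.prems show ?thesis by blast
    next
      case False
      then obtain e where e: "e \<in> A" "\<not> (\<exists>S. bridge_cut A e S)" by blast
      let ?B = "A - {e}"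
      have ins: "insert e ?B = A" using e by auto
      have inj: "inj_on edge_vec A"
        using loopfree_potential[OF psubset.prems(2)] by (intro inj_on_edge_vec) auto
      obtain c where c: "edge_vec e = (\<Sum>a\<in>?B. c a *\<^sub>R edge_vec a)" "sum c ?B = 1"
        using edge_vec_affine_combination[of ?B l e] remove_non_bridge[OF psubset.prems(1) e(2)]
          psubset.prems(2) ins by metis
      obtain f where f: "f \<in> ?B" "c f > 0" "x \<in> convex hull (edge_vec ` (A - {f}))"
        by (rule convex_hull_exchange[of ?B e edge_vec c x, unfolded ins, OF _ _ inj c psubset.prems(3)])
          auto
      have "\<not> (\<exists>S. bridge_cut A f S)"
      proof
        assume "\<exists>S. bridge_cut A f S"
        then obtain S where S: "bridge_cut A f S" ..
        then have "bridge_cut ?B f S" by (auto simp: bridge_cut_def)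
        from bridge_coefficient[OF c(1) f(1) this] cut_vec_bridge[OF S e(1)] f(1,2)
        show False by auto
      qed
      then have "cut_connected (A - {f})" by (rule remove_non_bridge[OF psubset.prems(1)])
      moreover have "is_potential l (A - {f})"
        using psubset.prems(2) by (auto simp: is_potential_def)
      moreover have "A - {f} \<subset> A" using f(1) by auto
      ultimately show ?thesis using psubset.IH f(3) by (meson Diff_subset subset_trans)
    qed
  qed
  then show ?thesis using that by blast
qed

lemma affine_hull_cut_connected:
  assumes "cut_connected A" "A \<subseteq> E" "is_potential l E"
  shows "affine hull (edge_vec ` A) = affine hull (edge_vec ` E)"
proof (rule hull_unique[symmetric])
  have inj: "inj_on edge_vec A"
    using loopfree_potential[OF assms(3)] assms(2) by (intro inj_on_edge_vec) auto
  show "affine (affine hull (edge_vec ` A))" by (rule affine_affine_hull)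
  show "edge_vec ` E \<subseteq> affine hull (edge_vec ` A)"
  proof clarify
    fix t h assume "(t, h) \<in> E"
    with assms have "is_potential l (insert (t, h) A)" by (auto simp: is_potential_def)
    from edge_vec_affine_combination[OF assms(1) this]
    obtain c where c: "edge_vec (t, h) = (\<Sum>a\<in>A. c a *\<^sub>R edge_vec a)" "sum c A = 1" .
    let ?u = "\<lambda>y. c (the_inv_into A edge_vec y)"
    have "sum ?u (edge_vec ` A) = 1" "(\<Sum>y\<in>edge_vec ` A. ?u y *\<^sub>R y) = edge_vec (t, h)"
      using inj c by (simp_all add: sum.reindex the_inv_into_f_f)
    then show "edge_vec (t, h) \<in> affine hull (edge_vec ` A)"
      by (subst affine_hull_finite) auto
  qed
  show "affine hull (edge_vec ` A) \<subseteq> T" if "edge_vec ` E \<subseteq> T" "affine T" for T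
    using that assms(2) by (intro hull_minimal) auto
qed

lemma affine_independent_cut_tree:
  assumes "cut_tree A" 
  shows "\<not> affine_dependent (edge_vec ` A)"
proof
  assume "affine_dependent (edge_vec ` A)"
  then obtain f where f: "f \<in> A" "edge_vec f \<in> affine hull (edge_vec ` A - {edge_vec f})"
    by (auto simp: affine_dependent_def)
  then obtain S where S: "bridge_cut A f S" using assms by (auto simp: cut_tree_def)
  have "affine hull (edge_vec ` A - {edge_vec f}) \<subseteq> {y. cut_vec S \<bullet> y = 0}"
    using cut_vec_bridge[OF S] by (intro hull_minimal affine_hyperplane) auto
  with f(2) cut_vec_bridge[OF S f(1)] show False by auto
qed

lemma simplex_cut_tree:
  assumes "cut_tree A" "A \<subseteq> E" "is_potential l E"
  shows "aff_dim (convex hull (edge_vec ` E)) simplex (convex hull (edge_vec ` A))"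
proof -
  have "aff_dim (convex hull (edge_vec ` E)) = aff_dim (edge_vec ` A)"
    using affine_hull_cut_connected[OF _ assms(2,3)] assms(1)
    by (metis aff_dim_affine_hull aff_dim_convex_hull cut_tree_def)
  moreover have "int (card (edge_vec ` A)) = aff_dim (edge_vec ` A) + 1"
    using aff_dim_affine_independent[OF affine_independent_cut_tree[OF assms(1)]] by simp
  ultimately show ?thesis
    unfolding simplex_def using affine_independent_cut_tree[OF assms(1)] by auto
qed

text \<open>
  A common interior point would lie on the hyperplane, and moving it slightly away from \<open>z\<close>
  inside \<open>H\<close> would lead out of \<open>P\<close>.
\<close>

lemma disjnt_interiors_if_separated:
  fixes y :: "'a::euclidean_space"
  assumes P: "\<And>x. x \<in> P \<Longrightarrow> 0 \<le> y \<bullet> x" and Q: "\<And>x. x \<in> Q \<Longrightarrow> y \<bullet> x \<le> 0"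
    and z: "z \<in> H" "0 < y \<bullet> z" and H: "affine H"
  shows "disjnt (top_of_set H interior_of P) (top_of_set H interior_of Q)"
  unfolding disjnt_iff
proof (intro allI notI)
  fix x assume x: "x \<in> top_of_set H interior_of P \<and> x \<in> top_of_set H interior_of Q"
  then have "x \<in> P" "x \<in> Q"
    using interior_of_subset[of "top_of_set H" P] interior_of_subset[of "top_of_set H" Q] by blast+
  with P Q have 0: "y \<bullet> x = 0" by (meson antisym)
  let ?W = "top_of_set H interior_of P"
  have "openin (top_of_set H) ?W" by simp
  then obtain d where d: "d > 0" "ball x d \<inter> H \<subseteq> ?W" and "x \<in> H"
    using x unfolding openin_contains_ball by blast
  define s where "s = d / (2 * norm (x - z))"
  have "x \<noteq> z" using 0 z by auto
  then have "s > 0" using d by (simp add: s_def)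
  let ?w = "(1 + s) *\<^sub>R x + (- s) *\<^sub>R z"
  have "?w \<in> H" using \<open>x \<in> H\<close> z(1) H by (intro mem_affine) auto
  moreover have "dist x ?w < d"
  proof -
    have "x - ?w = - (s *\<^sub>R (x - z))" by (simp add: algebra_simps)
    then have "dist x ?w = s * norm (x - z)" using \<open>s > 0\<close> by (simp add: dist_norm)
    also have "\<dots> = d / 2" using \<open>x \<noteq> z\<close> by (simp add: s_def)
    finally show ?thesis using d(1) by simp
  qed
  ultimately have "?w \<in> P" using d(2) interior_of_subset[of "top_of_set H" P] by auto
  then have "0 \<le> y \<bullet> ?w" by (rule P)
  moreover have "y \<bullet> ?w = - s * (y \<bullet> z)" using 0 by (simp add: inner_add_right inner_diff_right)
  ultimately show False using z(2) \<open>s > 0\<close> by (simp add: mult_le_0_iff zero_le_mult_iff)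
qed

section \<open>The dissection by Jaeger trees\<close>

context based_ribbon_graph
begin

lemma jaeger_tree_iff:
  "jaeger_tree G \<rho> b T \<longleftrightarrow>
     pverts T = UNIV \<and> parcs T \<subseteq> parcs G \<and> cut_tree (parcs T) \<and> jaeger_condition T"
  by (auto simp: jaeger_tree_def jaeger_condition_def spanning_tree_iff_cut_tree[OF directed])

text \<open>
  The number of all node-edge pairs bounds the length of every tour, so it serves as a common number
  of digits when the scores of different trees are compared.
\<close>

lemma exists_jaeger_tree_containing:
  assumes conn: "cut_connected (parcs G)" and l: "is_potential l (parcs G)"
    and x: "x \<in> root_polytope G"
  obtains T where "jaeger_tree G \<rho> b T" "x \<in> root_polytope T"
proof -
  define graph where "graph A = \<lparr>pverts = UNIV :: 'v set, parcs = A\<rparr>" for A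
  have [simp]: "parcs (graph A) = A" "pverts (graph A) = UNIV" for A by (simp_all add: graph_def)
  define \<A> where "\<A> = {A. A \<subseteq> parcs G \<and> cut_tree A \<and> x \<in> convex hull (edge_vec ` A)}"
  let ?N = "CARD('v \<times> ('v \<times> 'v))"
  have "\<A> \<noteq> {}"
    using exists_cut_tree_containing[OF conn l] x unfolding \<A>_def root_polytope_eq by blast
  let ?s = "\<lambda>A. score (graph A) ?N"
  have "Max (?s ` \<A>) \<in> ?s ` \<A>" using \<open>\<A> \<noteq> {}\<close> by (intro Max_in) auto
  then obtain A where A: "A \<in> \<A>" "Max (?s ` \<A>) = ?s A" by auto
  have max: "?s B \<le> ?s A" if "B \<in> \<A>" for B
    unfolding A(2)[symmetric] using that by (intro Max_ge) auto
  from A(1) have A': "A \<subseteq> parcs G" "cut_tree A" "x \<in> convex hull (edge_vec ` A)"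
    by (auto simp: \<A>_def)
  have "jaeger_condition (graph A)"
    unfolding jaeger_condition_def
  proof (intro allI impI, rule ccontr)
    fix t h :: 'v
    let ?e = "(t, h)"
    assume e: "?e \<in> parcs G - parcs (graph A)"
      and viol: "\<not> precedes (tour \<rho> b (graph A)) (t, ?e) (h, ?e)"
    from e A' have eA: "insert ?e A \<subseteq> parcs G" "?e \<notin> A" by auto
    with l have lA: "is_potential l (insert ?e A)" by (auto simp: is_potential_def)
    obtain c where c: "edge_vec ?e = (\<Sum>a\<in>A. c a *\<^sub>R edge_vec a)" "sum c A = 1"
      using edge_vec_affine_combination[OF _ lA] A'(2) by (auto simp: cut_tree_def)
    have inj: "inj_on edge_vec (insert ?e A)"
      using loopfree_potential[OF lA] by (intro inj_on_edge_vec)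
    have "x \<in> convex hull (edge_vec ` insert ?e A)"
      using A'(3) hull_mono[of "edge_vec ` A" "edge_vec ` insert ?e A" convex] by blast
    from convex_hull_exchange[OF finite eA(2) inj c this]
    obtain f where f: "f \<in> A" "c f > 0" "x \<in> convex hull (edge_vec ` (insert ?e A - {f}))" .
    obtain S where S: "bridge_cut A f S" using A'(2) f(1) by (auto simp: cut_tree_def)
    have "cut_vec S \<bullet> edge_vec ?e > 0" using bridge_coefficient[OF c(1) f(1) S] f(2) by simp
    then have side: "h \<in> S" "t \<notin> S" by (auto simp: cut_vec_edge_vec split: if_splits)
    then have "cut_tree (insert ?e A - {f})"
      using cut_tree_exchange[OF A'(2) f(1) S _ eA(2)] by (auto simp: crosses_def)
    with f(3) eA have "insert ?e A - {f} \<in> \<A>" by (auto simp: \<A>_def)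
    then have "score (graph (insert ?e A - {f})) ?N \<le> score (graph A) ?N" by (rule max)
    moreover have "score (graph A) ?N < score (graph (insert ?e A - {f})) ?N"
      using exchange_improves_score[of "graph A" t h f S "graph (insert ?e A - {f})" ?N]
        A' e viol f(1) S side tour_length_le by simp
    ultimately show False by simp
  qed
  with A' that[of "graph A"] show ?thesis by (auto simp: jaeger_tree_iff root_polytope_eq)
qed

lemma disjnt_jaeger_interiors:
  assumes T: "jaeger_tree G \<rho> b T" and T': "jaeger_tree G \<rho> b T'" and ne: "T \<noteq> T'"
  shows "disjnt (top_of_set (affine hull root_polytope G) interior_of root_polytope T)
                (top_of_set (affine hull root_polytope G) interior_of root_polytope T')"
proof -
  have *: "disjnt (top_of_set (affine hull root_polytope G) interior_of root_polytope T)
                (top_of_set (affine hull root_polytope G) interior_of root_polytope T')"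
    if "parcs T \<subseteq> parcs G" "g \<in> parcs T" "bridge_cut (parcs T) g S"
      "\<forall>f\<in>parcs T'. snd f \<in> S \<longrightarrow> fst f \<in> S" for T T' g S
  proof (rule disjnt_interiors_if_separated[where y = "cut_vec S" and z = "edge_vec g"])
    have "root_polytope T \<subseteq> {x. 0 \<le> cut_vec S \<bullet> x}"
      unfolding root_polytope_eq using cut_vec_bridge[OF that(3)]
      by (intro hull_minimal convex_halfspace_ge) auto
    then show "0 \<le> cut_vec S \<bullet> x" if "x \<in> root_polytope T" for x using that by auto
    have "root_polytope T' \<subseteq> {x. cut_vec S \<bullet> x \<le> 0}"
      unfolding root_polytope_eq using that(4)
      by (intro hull_minimal convex_halfspace_le) (auto simp: cut_vec_edge_vec)
    then show "cut_vec S \<bullet> x \<le> 0" if "x \<in> root_polytope T'" for x using that by auto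
    show "edge_vec g \<in> affine hull root_polytope G"
      unfolding root_polytope_eq affine_hull_convex_hull using that(1,2) by (intro hull_inc) auto
    show "0 < cut_vec S \<bullet> edge_vec g" using cut_vec_bridge[OF that(3,2)] by simp
  qed (rule affine_affine_hull)
  note J = T[unfolded jaeger_tree_iff] T'[unfolded jaeger_tree_iff]
  have "parcs T \<noteq> parcs T'"
    using ne J pair_pre_digraph.equality[of T T'] by auto
  with J have "(\<exists>g S. g \<in> parcs T \<and> bridge_cut (parcs T) g S \<and>
            (\<forall>f\<in>parcs T'. snd f \<in> S \<longrightarrow> fst f \<in> S)) \<or>
         (\<exists>g S. g \<in> parcs T' \<and> bridge_cut (parcs T') g S \<and>
            (\<forall>f\<in>parcs T. snd f \<in> S \<longrightarrow> fst f \<in> S))"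
    by (intro separating_cut) auto
  then show ?thesis
  proof (elim disjE exE conjE)
    fix g S assume "g \<in> parcs T" "bridge_cut (parcs T) g S" "\<forall>f\<in>parcs T'. snd f \<in> S \<longrightarrow> fst f \<in> S"
    with J show ?thesis by (intro *) auto
  next
    fix g S assume "g \<in> parcs T'" "bridge_cut (parcs T') g S" "\<forall>f\<in>parcs T. snd f \<in> S \<longrightarrow> fst f \<in> S"
    with J show ?thesis by (intro disjnt_sym[OF *]) auto
  qed
qed

end

theorem theorem5p8:
  fixes G :: "'v::finite pair_pre_digraph"
    and \<rho> :: "'v \<Rightarrow> 'v \<times> 'v \<Rightarrow> 'v \<times> 'v"
    and b\<^sub>0 :: 'v and e\<^sub>0 :: "'v \<times> 'v"
  assumes "directed_graph G"
    and "Digraph_Component.connected (with_proj G)"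
    and "semi_balanced G"
    and "ribbon_structure G \<rho>"
    and "e\<^sub>0 \<in> incident_edges G b\<^sub>0"
  shows "(\<forall>T. jaeger_tree G \<rho> (b\<^sub>0, e\<^sub>0) T \<longrightarrow>
            aff_dim (root_polytope G) simplex root_polytope T \<and>
            root_polytope T \<subseteq> root_polytope G) \<and>
         (\<forall>T T'. jaeger_tree G \<rho> (b\<^sub>0, e\<^sub>0) T \<and> jaeger_tree G \<rho> (b\<^sub>0, e\<^sub>0) T' \<and> T \<noteq> T' \<longrightarrow>
            disjnt (top_of_set (affine hull root_polytope G) interior_of root_polytope T)
                   (top_of_set (affine hull root_polytope G) interior_of root_polytope T')) \<and>
         (\<Union>T\<in>{T. jaeger_tree G \<rho> (b\<^sub>0, e\<^sub>0) T}. root_polytope T) = root_polytope G"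
proof -
  interpret based_ribbon_graph G \<rho> "(b\<^sub>0, e\<^sub>0)" using assms by unfold_locales auto
  have conn: "cut_connected (parcs G)"
    using assms(1,2) connected_iff_cut_connected[of G] by (auto simp: directed_graph_def)
  obtain A where "cut_tree A" "A \<subseteq> parcs G" using exists_cut_tree[OF conn] .
  then obtain l where l: "is_potential l (parcs G)"
    using semi_balanced_potential[OF assms(1,3)] by blast
  have sub: "root_polytope T \<subseteq> root_polytope G" if "jaeger_tree G \<rho> (b\<^sub>0, e\<^sub>0) T" for T
    using that unfolding jaeger_tree_iff root_polytope_eq by (intro hull_mono) auto
  have "aff_dim (root_polytope G) simplex root_polytope T"
    if "jaeger_tree G \<rho> (b\<^sub>0, e\<^sub>0) T" for T
    using that simplex_cut_tree[OF _ _ l] by (simp add: jaeger_tree_iff root_polytope_eq)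
  moreover have "root_polytope G \<subseteq> (\<Union>T\<in>{T. jaeger_tree G \<rho> (b\<^sub>0, e\<^sub>0) T}. root_polytope T)"
    using exists_jaeger_tree_containing[OF conn l] by blast
  ultimately show ?thesis
    using sub disjnt_jaeger_interiors by (intro conjI allI impI equalityI UN_least) auto
qed

end
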